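(* Let $K$ be a finite field extension of $\mathbb Q$. Let $d\ge 2$ and fix $i$ with $0\le i\le d$. Let $a_j\in K$ be given for all $j\in\{0,\dots,d\}\setminus\{i\}$, such that $a_0\neq 0$ if $i\neq 0$ and $a_d\neq 0$ if $i\neq d$. Then there exists a nonzero integer $a_i\in\mathbb Z$ such that the polynomial $f(x)=a_dx^d+a_{d-1}x^{d-1}+\cdots+a_1x+a_0$ has no roots in $K$. *)

theory Defs
  imports Complex_Main "HOL-Computational_Algebra.Polynomial"
begin

(* A field of characteristic 0 contains exactly one copy of the rationals, namely the range of
   of_rat, so being an extension of the rationals is the sort constraint field_char_0. *)
definition rat_scale :: "rat \<Rightarrow> 'k::field_char_0 \<Rightarrow> 'k" where
  "rat_scale q x = of_rat q * x"

lemma vector_space_rat_scale: "vector_space rat_scale"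
  by unfold_locales (simp_all add: rat_scale_def algebra_simps of_rat_add of_rat_mult)

definition finite_extension_of_rat :: "'k::field_char_0 itself \<Rightarrow> bool" where
  "finite_extension_of_rat _ \<longleftrightarrow>
     (\<exists>B :: 'k set. finite_dimensional_vector_space rat_scale B)"

end

(* Reversing the polynomial reduces the case i = d to i = 0.  Let i < d.  K embeds into a number
   field Q(theta), and for infinitely many primes p there is a place of Q(theta) with residue field
   F_p at which all nonzero a_j are units.  As a_d is a unit, every root in K is integral at this
   place, so it suffices to find a class n mod p for which the reduced polynomial has no root in F_p.
   If 0 < i < d, the roots are units because a_0 is one, and each of the p - 1 elements t of F_p^*
   is a root for exactly one class n; hence one of the p classes is missed.
   If i = 0, write f = n + g.  As deg g >= 2, some integer y is a simple root of g - g(y), which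
   therefore has another root beta in an algebraic closure.  Choosing Q(theta) to contain beta and
   the place such that beta - y is a unit makes g non-injective, hence non-surjective, on F_p. *)

theory Submission
  imports "HOL-Algebra.Algebraic_Closure_Type" Defs
begin

subsection \<open>Algebraic numbers and simple extensions of the rationals\<close>

interpretation rat_vs: vector_space rat_scale
  by (rule vector_space_rat_scale)

text \<open>Dependence is a property of sets, so a coincidence of two powers is treated first: it
  makes \<open>x\<close> a root of \<open>X^i - X^j\<close>. Otherwise \<open>card B + 1\<close>
  distinct powers lie in the span of \<open>B\<close>, and a linear relation among them is a
  rational polynomial vanishing at \<open>x\<close>.\<close>

lemma algebraic_if_powers_in_span:
  fixes x :: "'a::field_char_0"
  assumes "finite B" and pow: "\<And>k. x ^ k \<in> rat_vs.span B"
  shows "algebraic x"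
proof (cases "inj_on (\<lambda>k. x ^ k) {..card B}")
  case False
  then obtain i j where ij: "i \<noteq> j" "x ^ i = x ^ j"
    by (auto simp: inj_on_def)
  show ?thesis
  proof (rule algebraicI')
    show "coeff (monom 1 i - monom 1 j) k \<in> \<rat>" for k :: nat and x :: 'a
      by simp
    have "coeff (monom 1 i - monom 1 j :: 'a poly) i \<noteq> 0"
      using ij by simp
    then show "(monom 1 i - monom 1 j :: 'a poly) \<noteq> 0"
      by (metis coeff_0)
    show "poly (monom 1 i - monom 1 j) x = 0"
      using ij by (simp add: poly_monom)
  qed
next
  case True
  define S where "S = (\<lambda>k. x ^ k) ` {..card B}"
  have "card S = Suc (card B)"
    using True by (simp add: S_def card_image)
  moreover have "S \<subseteq> rat_vs.span B"
    using pow by (auto simp: S_def)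
  ultimately have "rat_vs.dependent S"
    using rat_vs.independent_span_bound[OF \<open>finite B\<close>] by fastforce
  moreover have "finite S"
    by (simp add: S_def)
  ultimately obtain u where u: "\<exists>v\<in>S. u v \<noteq> 0" "(\<Sum>v\<in>S. rat_scale (u v) v) = 0"
    using rat_vs.dependent_finite by blast
  define P :: "'a poly" where "P = (\<Sum>k\<le>card B. monom (of_rat (u (x ^ k))) k)"
  have coeff_P: "coeff P j = (if j \<le> card B then of_rat (u (x ^ j)) else 0)" for j
    by (simp add: P_def coeff_sum)
  show ?thesis
  proof (rule algebraicI')
    show "coeff P j \<in> \<rat>" for j
      by (simp add: coeff_P)
    obtain k where "k \<le> card B" "u (x ^ k) \<noteq> 0"
      using u(1) by (auto simp: S_def)
    then have "coeff P k \<noteq> 0"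
      by (simp add: coeff_P)
    then show "P \<noteq> 0"
      by auto
    show "poly P x = 0"
      using u(2) by (simp add: P_def poly_sum poly_monom S_def sum.reindex[OF True] rat_scale_def)
  qed
qed

section \<open>Values of integer polynomials in characteristic zero\<close>

definition eval_int :: "int poly \<Rightarrow> 'a::field_char_0 \<Rightarrow> 'a" where
  "eval_int w x = poly (map_poly of_int w) x"

lemma eval_int_0 [simp]: "eval_int 0 x = 0"
  by (simp add: eval_int_def)

lemma eval_int_pCons [simp]: "eval_int (pCons c w) x = of_int c + x * eval_int w x"
  by (simp add: eval_int_def map_poly_pCons)

lemma eval_int_1 [simp]: "eval_int 1 x = 1"
  by (simp add: one_pCons)

lemma eval_int_add [simp]: "eval_int (v + w) x = eval_int v x + eval_int w x"
  by (induction v w rule: poly_induct2) (simp_all add: algebra_simps)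

lemma eval_int_minus [simp]: "eval_int (- w) x = - eval_int w x"
  by (induction w) (simp_all add: algebra_simps)

lemma eval_int_diff [simp]: "eval_int (v - w) x = eval_int v x - eval_int w x"
  using eval_int_add[of v "- w"] by simp

lemma eval_int_smult [simp]: "eval_int (smult c w) x = of_int c * eval_int w x"
  by (induction w) (simp_all add: algebra_simps)

lemma eval_int_mult [simp]: "eval_int (v * w) x = eval_int v x * eval_int w x"
  by (induction v) (simp_all add: algebra_simps)

lemma eval_int_pcompose [simp]: "eval_int (v \<circ>\<^sub>p w) x = eval_int v (eval_int w x)"
  by (induction v) (simp_all add: pcompose_pCons)

text \<open>If \<open>u(x)\<close> is a root of \<open>c + X r(X)\<close> with
  \<open>c \<noteq> 0\<close>, then \<open>- r(u(x))\<close> is the required cofactor and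
  \<open>N = c\<close>. This integer multiple plays the part of a norm.\<close>

lemma eval_int_multiple_of_int:
  fixes x :: "'a::field_char_0"
  assumes "algebraic (eval_int u x)" "eval_int u x \<noteq> 0"
  obtains w N where "N \<noteq> 0" "eval_int w x * eval_int u x = of_int N"
proof -
  obtain q where q: "poly (map_poly of_int q) (eval_int u x) = 0" "coeff q 0 \<noteq> 0"
    using algebraicE'_nonzero[OF assms] by metis
  obtain c r where cr: "q = pCons c r"
    by (cases q)
  have "of_int c + eval_int u x * eval_int r (eval_int u x) = 0"
    using q(1) by (simp add: cr map_poly_pCons eval_int_def)
  then have "eval_int (- (r \<circ>\<^sub>p u)) x * eval_int u x = of_int c"
    by (simp add: algebra_simps add_eq_0_iff2)
  then show thesis
    using q(2) that[of c "- (r \<circ>\<^sub>p u)"] by (simp add: cr)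
qed

text \<open>The ring \<rat>[\<theta>], written with integer numerators and one common denominator so
  that the same numerators can later be evaluated at an integer modulo a prime. It is a field as
  soon as all values \<open>eval_int w \<theta>\<close> are algebraic.\<close>

definition simple_ext :: "'a::field_char_0 \<Rightarrow> 'a set" where
  "simple_ext \<theta> = {x. \<exists>u k. k \<noteq> 0 \<and> of_int k * x = eval_int u \<theta>}"

lemma simple_extI: "k \<noteq> 0 \<Longrightarrow> of_int k * x = eval_int u \<theta> \<Longrightarrow> x \<in> simple_ext \<theta>"
  by (auto simp: simple_ext_def)

lemma simple_extE:
  assumes "x \<in> simple_ext \<theta>"
  obtains u k where "k \<noteq> 0" "of_int k * x = eval_int u \<theta>"
  using assms by (auto simp: simple_ext_def)

lemma simple_ext_eval_int [simp]: "eval_int u \<theta> \<in> simple_ext \<theta>"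
  by (rule simple_extI[of 1 _ u]) simp_all

lemma simple_ext_generator [simp]: "\<theta> \<in> simple_ext \<theta>"
  using simple_ext_eval_int[of "[:0, 1:]" \<theta>] by simp

lemma simple_ext_of_int [simp]: "of_int k \<in> simple_ext \<theta>"
  using simple_ext_eval_int[of "[:k:]" \<theta>] by simp

lemma simple_ext_0 [simp]: "0 \<in> simple_ext \<theta>"
  and simple_ext_1 [simp]: "1 \<in> simple_ext \<theta>"
  using simple_ext_of_int[of 0 \<theta>] simple_ext_of_int[of 1 \<theta>] by simp_all

lemma simple_ext_add:
  assumes "x \<in> simple_ext \<theta>" "y \<in> simple_ext \<theta>"
  shows "x + y \<in> simple_ext \<theta>"
proof -
  obtain u k where u: "k \<noteq> 0" "of_int k * x = eval_int u \<theta>"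
    using assms(1) by (rule simple_extE)
  obtain v l where v: "l \<noteq> 0" "of_int l * y = eval_int v \<theta>"
    using assms(2) by (rule simple_extE)
  show ?thesis
  proof (rule simple_extI)
    show "k * l \<noteq> 0"
      using u v by simp
    show "of_int (k * l) * (x + y) = eval_int (smult l u + smult k v) \<theta>"
      by (simp add: algebra_simps flip: u(2) v(2))
  qed
qed

lemma simple_ext_mult:
  assumes "x \<in> simple_ext \<theta>" "y \<in> simple_ext \<theta>"
  shows "x * y \<in> simple_ext \<theta>"
proof -
  obtain u k where u: "k \<noteq> 0" "of_int k * x = eval_int u \<theta>"
    using assms(1) by (rule simple_extE)
  obtain v l where v: "l \<noteq> 0" "of_int l * y = eval_int v \<theta>"
    using assms(2) by (rule simple_extE)
  show ?thesis
  proof (rule simple_extI)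
    show "k * l \<noteq> 0"
      using u v by simp
    show "of_int (k * l) * (x * y) = eval_int (u * v) \<theta>"
      by (simp add: algebra_simps flip: u(2) v(2))
  qed
qed

lemma simple_ext_minus: "x \<in> simple_ext \<theta> \<Longrightarrow> - x \<in> simple_ext \<theta>"
  using simple_ext_mult[of "of_int (- 1)" \<theta> x] simple_ext_of_int[of "-1" \<theta>] by simp

lemma simple_ext_diff: "x \<in> simple_ext \<theta> \<Longrightarrow> y \<in> simple_ext \<theta> \<Longrightarrow> x - y \<in> simple_ext \<theta>"
  using simple_ext_add[of x \<theta> "- y"] simple_ext_minus[of y \<theta>] by simp

text \<open>From \<open>k x = u(\<theta>)\<close> and a cofactor with
  \<open>w(\<theta>) u(\<theta>) = N\<close> follows \<open>N / x = k w(\<theta>)\<close>.\<close>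

lemma simple_ext_inverse:
  assumes alg: "\<And>w. algebraic (eval_int w \<theta>)" and x: "x \<in> simple_ext \<theta>"
  shows "inverse x \<in> simple_ext \<theta>"
proof (cases "x = 0")
  case False
  obtain u k where u: "k \<noteq> 0" "of_int k * x = eval_int u \<theta>"
    using x by (rule simple_extE)
  then have "eval_int u \<theta> \<noteq> 0"
    using False by (metis mult_eq_0_iff of_int_eq_0_iff)
  then obtain w N where N: "N \<noteq> 0" "eval_int w \<theta> * eval_int u \<theta> = of_int N"
    using eval_int_multiple_of_int[OF alg] by metis
  have "of_int N * inverse x = eval_int (smult k w) \<theta>"
    using False by (simp add: field_simps flip: u(2) N(2))
  then show ?thesis
    using N(1) simple_extI by blast
qed simp

lemma simple_ext_of_rat: "of_rat q \<in> simple_ext \<theta>"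
proof -
  obtain a b where "quotient_of q = (a, b)" by force
  then have q: "q = of_int a / of_int b" and b: "b > 0"
    by (simp_all add: quotient_of_div quotient_of_denom_pos)
  show ?thesis
    by (rule simple_extI[of b _ "[:a:]"]) (use b in \<open>simp_all add: q of_rat_divide\<close>)
qed

text \<open>In characteristic 0 the derivative of a nonconstant \<open>h\<close> is nonzero and has
  smaller degree, so minimality keeps it from vanishing at \<open>x\<close>: the root is
  simple.\<close>

lemma algebraic_least_polyE:
  fixes x :: "'a::field_char_0"
  assumes "algebraic x"
  obtains h where "h \<noteq> 0" "eval_int h x = 0" "degree h > 0" "eval_int (pderiv h) x \<noteq> 0"
    "\<And>w. w \<noteq> 0 \<Longrightarrow> eval_int w x = 0 \<Longrightarrow> degree h \<le> degree w"
proof -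
  have "\<exists>h. h \<noteq> 0 \<and> eval_int h x = 0"
    using algebraicE'[OF assms] unfolding eval_int_def by metis
  then obtain h where h: "h \<noteq> 0" "eval_int h x = 0"
    and least: "\<And>w. w \<noteq> 0 \<Longrightarrow> eval_int w x = 0 \<Longrightarrow> degree h \<le> degree w"
    using ex_has_least_nat[of "\<lambda>h. h \<noteq> 0 \<and> eval_int h x = 0" _ degree] by metis
  have deg_h: "degree h > 0"
    using h by (cases h) (auto split: if_splits)
  then have "pderiv h \<noteq> 0"
    by (simp add: pderiv_eq_0_iff)
  then have "eval_int (pderiv h) x \<noteq> 0"
    using least[of "pderiv h"] deg_h by (auto simp: degree_pderiv)
  then show thesis
    using that h deg_h least by blast
qed

subsection \<open>Primitive elements\<close>

text \<open>Division with remainder, cancelling one leading term at a time, so that all coefficients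
  visibly stay in the subfield \<open>F\<close> and minimality of \<open>q\<close> applies to each
  intermediate polynomial.\<close>

lemma minimal_poly_dvd:
  fixes F :: "'a::field_char_0 set"
  assumes diff: "\<And>x y. x \<in> F \<Longrightarrow> y \<in> F \<Longrightarrow> x - y \<in> F"
    and mult: "\<And>x y. x \<in> F \<Longrightarrow> y \<in> F \<Longrightarrow> x * y \<in> F"
    and inv: "\<And>x. x \<in> F \<Longrightarrow> inverse x \<in> F"
    and q: "\<And>i. coeff q i \<in> F" "q \<noteq> 0" "poly q \<beta> = 0"
    and least: "\<And>w. (\<And>i. coeff w i \<in> F) \<Longrightarrow> w \<noteq> 0 \<Longrightarrow> poly w \<beta> = 0 \<Longrightarrow> degree q \<le> degree w"
  shows "(\<And>i. coeff w i \<in> F) \<Longrightarrow> poly w \<beta> = 0 \<Longrightarrow> q dvd w"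
proof (induction "degree w" arbitrary: w rule: less_induct)
  case less
  show ?case
  proof (cases "w = 0")
    case False
    then have le: "degree q \<le> degree w"
      using least less.prems by blast
    define c where "c = lead_coeff w / lead_coeff q"
    define e where "e = degree w - degree q"
    define v where "v = w - monom c e * q"
    have "0 \<in> F"
      using diff[OF q(1)[of 0] q(1)[of 0]] by simp
    then have v_F: "coeff v i \<in> F" for i
      using less.prems(1) q(1)
      by (auto simp: v_def coeff_monom_mult c_def divide_inverse intro!: diff mult inv)
    have v_root: "poly v \<beta> = 0"
      using less.prems(2) q(3) by (simp add: v_def)
    have "degree (monom c e * q) \<le> degree w"
      using le degree_mult_le[of "monom c e" q] degree_monom_le[of c e] by (simp add: e_def)
    then have "degree v \<le> degree w"
      by (simp add: v_def degree_diff_le)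
    moreover have "coeff v (degree w) = 0"
      using le q(2) by (simp add: v_def coeff_monom_mult e_def c_def)
    ultimately have "v = 0 \<or> degree v < degree w"
      by (rule eq_zero_or_degree_less)
    then have "q dvd v"
      using less.hyps[of v] v_F v_root by auto
    then have "q dvd v + monom c e * q"
      by (intro dvd_add) auto
    then show ?thesis
      by (simp add: v_def)
  qed simp
qed

text \<open>The classical argument for primitive elements: over \<rat>(\<theta>), a polynomial of
  least degree with root \<beta> divides both \<open>g\<close> and \<open>f(\<theta> - c X)\<close>.
  By \<open>sep\<close> these share no root except \<beta>, which is simple for \<open>g\<close>; so
  the polynomial is linear and \<beta> is a quotient of its coefficients.\<close>

lemma simple_ext_separating_shift:
  fixes \<alpha> \<beta> :: "'a::{field_char_0, alg_closed_field}"
  assumes alg: "\<And>w. algebraic (eval_int w (\<alpha> + of_int c * \<beta>))"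
    and f: "f \<noteq> 0" "eval_int f \<alpha> = 0"
    and g: "g \<noteq> 0" "eval_int g \<beta> = 0" "eval_int (pderiv g) \<beta> \<noteq> 0"
    and sep: "\<And>\<gamma>. eval_int g \<gamma> = 0 \<Longrightarrow> \<gamma> \<noteq> \<beta> \<Longrightarrow> eval_int f (\<alpha> + of_int c * (\<beta> - \<gamma>)) \<noteq> 0"
  shows "\<beta> \<in> simple_ext (\<alpha> + of_int c * \<beta>)"
proof -
  define \<theta> where "\<theta> = \<alpha> + of_int c * \<beta>"
  define F where "F = simple_ext \<theta>"
  define G where "G = map_poly (of_int :: int \<Rightarrow> 'a) g"
  \<comment> \<open>The value of \<open>H\<close> at \<gamma> is
    \<open>f(\<alpha> + c (\<beta> - \<gamma>))\<close>; it is 0 at \<beta>, and by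
    \<open>sep\<close> nonzero at every other root of \<open>g\<close>.\<close>
  define H where "H = map_poly (of_int :: int \<Rightarrow> 'a) f \<circ>\<^sub>p [:\<theta>, - of_int c:]"
  have G: "coeff G i \<in> F" for i
    by (simp add: G_def F_def coeff_map_poly)
  have poly_G: "poly G x = eval_int g x" for x
    by (simp add: G_def eval_int_def)
  have poly_H: "poly H x = eval_int f (\<theta> - of_int c * x)" for x
    by (simp add: H_def eval_int_def poly_pcompose algebra_simps)
  have H: "coeff H i \<in> F" for i
  proof -
    have "\<forall>i. coeff (map_poly of_int w \<circ>\<^sub>p [:\<theta>, - of_int c:]) i \<in> F" for w
    proof (induction w)
      case (pCons a w)
      show ?case
      proof
        fix i
        have "coeff (map_poly of_int (pCons a w) \<circ>\<^sub>p [:\<theta>, - of_int c:]) i =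
            coeff [:of_int a:] i + \<theta> * coeff (map_poly of_int w \<circ>\<^sub>p [:\<theta>, - of_int c:]) i
            - of_int c * (case i of 0 \<Rightarrow> 0 | Suc j \<Rightarrow> coeff (map_poly of_int w \<circ>\<^sub>p [:\<theta>, - of_int c:]) j)"
          by (simp add: map_poly_pCons pcompose_pCons coeff_pCons split: nat.splits)
        also have "\<dots> \<in> F"
          using pCons(2) unfolding F_def
          by (intro simple_ext_add simple_ext_diff simple_ext_mult)
             (auto simp: coeff_pCons split: nat.splits)
        finally show "coeff (map_poly of_int (pCons a w) \<circ>\<^sub>p [:\<theta>, - of_int c:]) i \<in> F" .
      qed
    qed (simp add: F_def)
    then show ?thesis
      by (simp add: H_def)
  qed
  have G_root: "G \<noteq> 0" "poly G \<beta> = 0" and H_root: "poly H \<beta> = 0"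
    using f g by (simp_all add: poly_G poly_H \<theta>_def) (simp add: G_def map_poly_eq_0_iff)
  have "\<exists>q. (\<forall>i. coeff q i \<in> F) \<and> q \<noteq> 0 \<and> poly q \<beta> = 0"
    using G G_root by blast
  then obtain q where q: "\<And>i. coeff q i \<in> F" "q \<noteq> 0" "poly q \<beta> = 0"
    and least: "\<And>w. (\<And>i. coeff w i \<in> F) \<Longrightarrow> w \<noteq> 0 \<Longrightarrow> poly w \<beta> = 0 \<Longrightarrow> degree q \<le> degree w"
    using ex_has_least_nat[of "\<lambda>q. (\<forall>i. coeff q i \<in> F) \<and> q \<noteq> 0 \<and> poly q \<beta> = 0" _ degree]
    by metis
  have q_dvd: "q dvd w" if "\<And>i. coeff w i \<in> F" "poly w \<beta> = 0" for w
    by (rule minimal_poly_dvd[of F q \<beta>])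
       (use q least that alg in \<open>auto simp: F_def \<theta>_def intro: simple_ext_diff simple_ext_mult simple_ext_inverse\<close>)
  have only_root: "\<gamma> = \<beta>" if "poly q \<gamma> = 0" for \<gamma>
  proof (rule ccontr)
    assume "\<gamma> \<noteq> \<beta>"
    have "poly G \<gamma> = 0" "poly H \<gamma> = 0"
      using q_dvd[OF G G_root(2)] q_dvd[OF H H_root] that by (auto elim!: dvdE)
    then show False
      using sep[of \<gamma>] \<open>\<gamma> \<noteq> \<beta>\<close> by (simp add: poly_G poly_H \<theta>_def algebra_simps)
  qed
  obtain r where r: "q = [:-\<beta>, 1:] * r"
    using q(3) by (auto simp: poly_eq_0_iff_dvd)
  \<comment> \<open>A root of \<open>r\<close> would again be \<beta>, and then the square of
    \<open>X - \<beta>\<close> would divide \<open>G\<close>.\<close>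
  have "degree r = 0"
  proof (rule ccontr)
    assume "degree r \<noteq> 0"
    then obtain \<gamma> where "poly r \<gamma> = 0"
      using alg_closed_imp_poly_has_root by blast
    moreover from this have "\<gamma> = \<beta>"
      by (intro only_root) (simp add: r)
    ultimately obtain r' where "r = [:-\<beta>, 1:] * r'"
      by (auto simp: poly_eq_0_iff_dvd)
    moreover obtain s where "G = q * s"
      using q_dvd[OF G G_root(2)] by (elim dvdE)
    ultimately have "G = [:-\<beta>, 1:] * ([:-\<beta>, 1:] * (r' * s))"
      by (simp only: r mult.assoc)
    then have "poly (pderiv G) \<beta> = 0"
      by (simp add: pderiv_mult pderiv_pCons del: mult_pCons_left)
    moreover have "pderiv G = map_poly of_int (pderiv g)"
      by (rule poly_eqI) (simp add: G_def coeff_pderiv coeff_map_poly)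
    ultimately show False
      using g(3) by (simp add: eval_int_def)
  qed
  then obtain a where "r = [:a:]"
    by (auto elim: degree_eq_zeroE)
  then have q_eq: "q = [:-\<beta> * a, a:]"
    by (simp add: r)
  then have "a \<noteq> 0" "a \<in> F" "- \<beta> * a \<in> F"
    using q(2) q(1)[of 0] q(1)[of 1] by auto
  then have "- (- \<beta> * a) * inverse a \<in> F"
    unfolding F_def using alg
    by (intro simple_ext_mult[OF simple_ext_minus simple_ext_inverse]) (simp_all add: \<theta>_def)
  then show ?thesis
    unfolding F_def \<theta>_def using \<open>a \<noteq> 0\<close> by (simp add: mult.assoc)
qed

text \<open>Each of the finitely many roots \<gamma> \<noteq> \<beta> of \<open>g\<close> excludes
  only finitely many \<open>c\<close>, since \<open>c\<close> is determined by the value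
  \<open>\<alpha> + c (\<beta> - \<gamma>)\<close>, which would have to be a root of
  \<open>f\<close>.\<close>

lemma ex_separating_shift:
  fixes \<alpha> \<beta> :: "'a::field_char_0"
  assumes "f \<noteq> 0" "g \<noteq> 0"
  obtains c :: int where
    "\<And>\<gamma>. eval_int g \<gamma> = 0 \<Longrightarrow> \<gamma> \<noteq> \<beta> \<Longrightarrow> eval_int f (\<alpha> + of_int c * (\<beta> - \<gamma>)) \<noteq> 0"
proof -
  have roots: "finite {x :: 'a. eval_int w x = 0}" if "w \<noteq> 0" for w
    unfolding eval_int_def using that by (intro poly_roots_finite) (simp add: map_poly_eq_0_iff)
  have "finite (\<Union>\<gamma>\<in>{\<gamma>. eval_int g \<gamma> = 0} - {\<beta>}.
      (\<lambda>c::int. \<alpha> + of_int c * (\<beta> - \<gamma>)) -` {x. eval_int f x = 0})"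
    using roots assms by (intro finite_UN_I finite_vimageI) (auto simp: inj_on_def)
  then obtain c where "c \<notin> (\<Union>\<gamma>\<in>{\<gamma>. eval_int g \<gamma> = 0} - {\<beta>}.
      (\<lambda>c::int. \<alpha> + of_int c * (\<beta> - \<gamma>)) -` {x. eval_int f x = 0})"
    using infinite_UNIV_int ex_new_if_finite by blast
  then show thesis
    using that by auto
qed

lemma simple_ext_mono:
  assumes "\<alpha> \<in> simple_ext \<theta>"
  shows "simple_ext \<alpha> \<subseteq> simple_ext \<theta>"
proof
  fix x assume "x \<in> simple_ext \<alpha>"
  then obtain u k where u: "k \<noteq> 0" "of_int k * x = eval_int u \<alpha>"
    by (rule simple_extE)
  have "eval_int w \<alpha> \<in> simple_ext \<theta>" for w
    by (induction w) (auto intro!: simple_ext_add simple_ext_mult assms)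
  then obtain v l where "l \<noteq> 0" "of_int l * eval_int u \<alpha> = eval_int v \<theta>"
    by (meson simple_extE)
  then show "x \<in> simple_ext \<theta>"
    using u by (intro simple_extI[of "l * k" x v]) (simp_all add: mult.assoc)
qed

text \<open>Elements of \<open>S\<close> are adjoined one at a time. Keeping \<theta> in the ring
  \<open>L\<close> makes every \<open>eval_int w \<theta>\<close> algebraic, as inversion in
  \<open>simple_ext \<theta>\<close> requires.\<close>

lemma primitive_element:
  fixes L :: "'a::{field_char_0, alg_closed_field} set"
  assumes add: "\<And>x y. x \<in> L \<Longrightarrow> y \<in> L \<Longrightarrow> x + y \<in> L"
    and mult: "\<And>x y. x \<in> L \<Longrightarrow> y \<in> L \<Longrightarrow> x * y \<in> L"
    and int: "\<And>k. of_int k \<in> L"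
    and alg: "\<And>x. x \<in> L \<Longrightarrow> algebraic x"
    and "finite S" "S \<subseteq> L"
  shows "\<exists>\<theta>\<in>L. S \<subseteq> simple_ext \<theta>"
  using assms(5,6)
proof (induction S)
  case empty
  then show ?case
    using int by blast
next
  case (insert \<beta> S)
  then obtain \<alpha> where \<alpha>: "\<alpha> \<in> L" "S \<subseteq> simple_ext \<alpha>" and \<beta>: "\<beta> \<in> L"
    by auto
  obtain f where f: "f \<noteq> 0" "eval_int f \<alpha> = 0"
    using alg[OF \<alpha>(1)] by (rule algebraic_least_polyE)
  obtain g where g: "g \<noteq> 0" "eval_int g \<beta> = 0" "eval_int (pderiv g) \<beta> \<noteq> 0"
    using alg[OF \<beta>] by (rule algebraic_least_polyE)
  obtain c :: int where
    sep: "\<And>\<gamma>. eval_int g \<gamma> = 0 \<Longrightarrow> \<gamma> \<noteq> \<beta> \<Longrightarrow> eval_int f (\<alpha> + of_int c * (\<beta> - \<gamma>)) \<noteq> 0"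
    using ex_separating_shift[OF f(1) g(1)] by metis
  define \<theta> where "\<theta> = \<alpha> + of_int c * \<beta>"
  have \<theta>: "\<theta> \<in> L"
    unfolding \<theta>_def by (intro add mult int \<alpha> \<beta>)
  have "eval_int w \<theta> \<in> L" for w
    by (induction w) (use int[of 0] in \<open>auto intro!: add mult int \<theta>\<close>)
  then have "\<beta> \<in> simple_ext \<theta>"
    unfolding \<theta>_def using alg f g sep by (intro simple_ext_separating_shift) (auto simp: \<theta>_def)
  then have "\<theta> - of_int c * \<beta> \<in> simple_ext \<theta>"
    by (intro simple_ext_diff simple_ext_mult) simp_all
  then have "simple_ext \<alpha> \<subseteq> simple_ext \<theta>"
    by (intro simple_ext_mono) (simp add: \<theta>_def)
  then show ?case
    using \<theta> \<alpha> \<open>\<beta> \<in> simple_ext \<theta>\<close> by blast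
qed

subsection \<open>Places of degree one\<close>

text \<open>A Euclid-style argument: for \<open>h = c + X g\<close> and \<open>m = c D t\<close> one
  gets \<open>h(m) = c e\<close> with \<open>e = 1 + D t g(m)\<close>, and a prime divisor of
  \<open>e\<close> cannot divide \<open>D\<close>. If \<open>c = 0\<close>, every prime divides
  \<open>h(0)\<close>.\<close>

lemma prime_dividing_value_avoiding:
  fixes h :: "int poly" and D :: int
  assumes "degree h > 0" "D \<noteq> 0"
  obtains p m where "prime p" "\<not> p dvd D" "p dvd poly h m"
proof (cases "coeff h 0 = 0")
  case True
  obtain q :: nat where q: "prime q" "nat \<bar>D\<bar> < q"
    using bigger_prime by blast
  then have "\<not> int q dvd D"
    using \<open>D \<noteq> 0\<close> dvd_imp_le_int[of D "int q"] by auto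
  moreover have "prime (int q)"
    using q(1) by simp
  moreover have "int q dvd poly h 0"
    using True by (simp add: poly_0_coeff_0)
  ultimately show thesis
    by (intro that)
next
  case False
  obtain c g where h: "h = pCons c g"
    by (cases h)
  have c: "c \<noteq> 0"
    using False by (simp add: h)
  have g: "g \<noteq> 0"
    using assms(1) by (auto simp: h)
  \<comment> \<open>The argument here stands for \<open>m\<close>. The factors \<open>g\<close> and
    \<open>X\<close> rule out \<open>e = 1\<close>, the factor \<open>h + c\<close> rules out
    \<open>e = -1\<close>, and \<open>h\<close> rules out \<open>e = 0\<close>; so \<open>e\<close>
    has a prime divisor.\<close>
  have "finite {t. poly (g * [:0, 1:] * (h + [:c:]) * h) t = 0}"
  proof (rule poly_roots_finite)
    have "degree (h + [:c:]) > 0"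
      using g by (simp add: h)
    then have "h + [:c:] \<noteq> 0"
      by auto
    then show "g * [:0, 1:] * (h + [:c:]) * h \<noteq> 0"
      using g assms(1) by (auto simp only: mult_eq_0_iff pCons_eq_0_iff degree_0)
  qed
  moreover have "\<not> finite (range (\<lambda>t::int. c * D * t))"
    using c assms(2) by (subst finite_image_iff) (auto simp: inj_on_def)
  ultimately obtain t where t: "poly (g * [:0, 1:] * (h + [:c:]) * h) (c * D * t) \<noteq> 0"
    by (metis (mono_tags, lifting) finite_subset image_subsetI mem_Collect_eq)
  define m where "m = c * D * t"
  define e where "e = 1 + D * t * poly g m"
  have hm: "poly h m = c * e"
    by (simp add: h e_def m_def algebra_simps)
  have "poly g m \<noteq> 0" "m \<noteq> 0" "poly h m + c \<noteq> 0" "poly h m \<noteq> 0"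
    using t unfolding m_def [symmetric] by auto
  then have "e \<noteq> 0" "e \<noteq> - 1"
    using hm by auto
  moreover have "e \<noteq> 1"
    using \<open>poly g m \<noteq> 0\<close> \<open>m \<noteq> 0\<close> assms(2) by (auto simp: e_def m_def)
  moreover from calculation have "\<bar>e\<bar> \<noteq> 1"
    by arith
  ultimately obtain p where p: "prime p" "p dvd e"
    using prime_divisor_exists[of e] by auto
  have "\<not> p dvd D"
  proof
    assume "p dvd D"
    then have "p dvd e - D * t * poly g m"
      using p(2) by (intro dvd_diff) auto
    then show False
      using p(1) not_prime_unit[of p] by (simp add: e_def)
  qed
  moreover have "p dvd poly h m"
    using p(2) by (simp add: hm)
  ultimately show thesis
    using p(1) that by blast
qed

text \<open>A place of \<open>\<rat>(\<theta>)\<close> with residue field \<open>\<int>/p\<close> that sends \<open>\<theta>\<close> to \<open>m\<close> and is unramified: the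
  assumption \<open>uniformizer\<close> puts \<open>\<theta> - m\<close> into the ideal generated by \<open>p\<close> in the local ring.
  The relation \<open>red x c\<close> below says that \<open>x\<close> lies in this local ring and has residue \<open>c\<close> modulo \<open>p\<close>.\<close>

locale degree_one_place =
  fixes \<theta> :: "'a::field_char_0" and p m :: int
  assumes prime: "prime p"
    and root: "eval_int w \<theta> = 0 \<Longrightarrow> p dvd poly w m"
    and uniformizer: "\<exists>h c. \<not> p dvd poly h m \<and> eval_int h \<theta> * (\<theta> - of_int m) = of_int (p * c)"
    and algebraic: "algebraic (eval_int w \<theta>)"
begin

lemma p_dvd_mult_iff [simp]: "p dvd a * b \<longleftrightarrow> p dvd a \<or> p dvd b"
  using prime by (rule prime_dvd_mult_iff)

lemma abs_p_neq_1 [simp]: "\<bar>p\<bar> \<noteq> 1"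
  using prime not_prime_unit[of p] by auto

lemma p_nonzero [simp]: "p \<noteq> 0"
  using prime by auto

definition red :: "'a \<Rightarrow> int \<Rightarrow> bool" where
  "red x c \<longleftrightarrow> (\<exists>u v. \<not> p dvd poly v m \<and> eval_int v \<theta> * x = eval_int u \<theta> \<and>
     p dvd poly u m - c * poly v m)"

lemma redI:
  "\<not> p dvd poly v m \<Longrightarrow> eval_int v \<theta> * x = eval_int u \<theta> \<Longrightarrow>
    p dvd poly u m - c * poly v m \<Longrightarrow> red x c"
  unfolding red_def by blast

lemma redE:
  assumes "red x c"
  obtains u v where "\<not> p dvd poly v m" "eval_int v \<theta> * x = eval_int u \<theta>"
    "p dvd poly u m - c * poly v m"
  using assms unfolding red_def by blast

text \<open>For two representations \<open>u/v\<close> and \<open>u'/v'\<close> of \<open>x\<close>,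
  the polynomial \<open>u v' - u' v\<close> vanishes at \<theta>, hence modulo \<open>p\<close> at
  \<open>m\<close>; the denominators are invertible there.\<close>

lemma red_unique:
  assumes "red x c" "red x c'"
  shows "p dvd c - c'"
proof -
  obtain u v where u: "\<not> p dvd poly v m" "eval_int v \<theta> * x = eval_int u \<theta>"
    "p dvd poly u m - c * poly v m"
    using assms(1) by (rule redE)
  obtain u' v' where u': "\<not> p dvd poly v' m" "eval_int v' \<theta> * x = eval_int u' \<theta>"
    "p dvd poly u' m - c' * poly v' m"
    using assms(2) by (rule redE)
  have "eval_int (u * v' - u' * v) \<theta> = 0"
    by (simp flip: u(2) u'(2))
  then have "p dvd poly (u * v' - u' * v) m"
    by (rule root)
  then have "p dvd poly (u * v' - u' * v) m - (poly u m - c * poly v m) * poly v' m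
      + (poly u' m - c' * poly v' m) * poly v m"
    using u(3) u'(3) by (intro dvd_add dvd_diff) auto
  also have "\<dots> = (c - c') * (poly v m * poly v' m)"
    by (simp add: algebra_simps)
  finally show ?thesis
    using u(1) u'(1) by simp
qed

lemma red_of_int [simp]: "red (of_int n) n"
  by (rule redI[of 1 _ "[:n:]"]) simp_all

lemma red_0 [simp]: "red 0 0" and red_1 [simp]: "red 1 1"
  using red_of_int[of 0] red_of_int[of 1] by simp_all

lemma red_add:
  assumes "red x c" "red x' c'"
  shows "red (x + x') (c + c')"
proof -
  obtain u v where u: "\<not> p dvd poly v m" "eval_int v \<theta> * x = eval_int u \<theta>"
    "p dvd poly u m - c * poly v m"
    using assms(1) by (rule redE)
  obtain u' v' where u': "\<not> p dvd poly v' m" "eval_int v' \<theta> * x' = eval_int u' \<theta>"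
    "p dvd poly u' m - c' * poly v' m"
    using assms(2) by (rule redE)
  show ?thesis
  proof (rule redI)
    show "\<not> p dvd poly (v * v') m"
      using u u' by simp
    show "eval_int (v * v') \<theta> * (x + x') = eval_int (u * v' + u' * v) \<theta>"
      by (simp add: algebra_simps flip: u(2) u'(2))
    have "p dvd (poly u m - c * poly v m) * poly v' m + (poly u' m - c' * poly v' m) * poly v m"
      using u(3) u'(3) by (intro dvd_add) auto
    then show "p dvd poly (u * v' + u' * v) m - (c + c') * poly (v * v') m"
      by (simp add: algebra_simps)
  qed
qed

lemma red_mult:
  assumes "red x c" "red x' c'"
  shows "red (x * x') (c * c')"
proof -
  obtain u v where u: "\<not> p dvd poly v m" "eval_int v \<theta> * x = eval_int u \<theta>"
    "p dvd poly u m - c * poly v m"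
    using assms(1) by (rule redE)
  obtain u' v' where u': "\<not> p dvd poly v' m" "eval_int v' \<theta> * x' = eval_int u' \<theta>"
    "p dvd poly u' m - c' * poly v' m"
    using assms(2) by (rule redE)
  show ?thesis
  proof (rule redI)
    show "\<not> p dvd poly (v * v') m"
      using u u' by simp
    show "eval_int (v * v') \<theta> * (x * x') = eval_int (u * u') \<theta>"
      by (simp add: algebra_simps flip: u(2) u'(2))
    have "p dvd (poly u m - c * poly v m) * poly u' m + (poly u' m - c' * poly v' m) * (c * poly v m)"
      using u(3) u'(3) by (intro dvd_add) auto
    then show "p dvd poly (u * u') m - (c * c') * poly (v * v') m"
      by (simp add: algebra_simps)
  qed
qed

lemma red_power: "red x c \<Longrightarrow> red (x ^ k) (c ^ k)"
  by (induction k) (simp_all add: red_mult)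

lemma red_sum: "(\<And>j. j \<in> J \<Longrightarrow> red (f j) (g j)) \<Longrightarrow> red (sum f J) (sum g J)"
  by (induction J rule: infinite_finite_induct) (simp_all add: red_add)

section \<open>The local ring of a place as a discrete valuation ring\<close>

lemma ex_red:
  assumes "\<not> p dvd poly v m" "eval_int v \<theta> * x = eval_int u \<theta>"
  shows "\<exists>c. red x c"
proof -
  have "gcd (poly v m) p = 1"
    using assms(1) prime prime_imp_coprime_int[of p "poly v m"] by (simp add: gcd.commute)
  then obtain s t where st: "s * poly v m + t * p = 1"
    using bezout_int[of "poly v m" p] by auto
  have "poly u m - (poly u m * s) * poly v m = poly u m * (1 - s * poly v m)"
    by (simp add: algebra_simps)
  also have "\<dots> = poly u m * (t * p)"
    using st by (simp add: eq_diff_eq')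
  finally show ?thesis
    using redI[OF assms, of "poly u m * s"] by auto
qed

text \<open>Residue 0 means divisible by \<open>p\<close> up to a local unit. Division of
  \<open>u\<close> by \<open>X - m\<close> leaves the remainder \<open>u(m)\<close>, a multiple of
  \<open>p\<close>, and \<open>h(\<theta>)\<close> turns \<open>\<theta> - m\<close> into a multiple
  of \<open>p\<close>.\<close>

lemma dvd_eval_int_local:
  assumes "p dvd poly u m"
  shows "\<exists>y z. \<not> p dvd poly y m \<and> eval_int y \<theta> * eval_int u \<theta> = of_int p * eval_int z \<theta>"
proof -
  obtain h c where h: "\<not> p dvd poly h m" "eval_int h \<theta> * (\<theta> - of_int m) = of_int (p * c)"
    using uniformizer by blast
  obtain b where b: "poly u m = p * b"
    using assms by (elim dvdE)
  define q where "q = synthetic_div u m"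
  have "eval_int u \<theta> = eval_int ([:-m, 1:] * q + [:poly u m:]) \<theta>"
    by (simp only: q_def synthetic_div_correct')
  then have "eval_int u \<theta> = (\<theta> - of_int m) * eval_int q \<theta> + of_int (p * b)"
    by (simp add: b left_diff_distrib)
  then have "eval_int h \<theta> * eval_int u \<theta> =
      (eval_int h \<theta> * (\<theta> - of_int m)) * eval_int q \<theta> + of_int (p * b) * eval_int h \<theta>"
    by (simp only: distrib_left mult_ac)
  also have "\<dots> = of_int p * eval_int (smult c q + smult b h) \<theta>"
    by (simp only: h(2)) (simp add: algebra_simps)
  finally show ?thesis
    using h(1) by blast
qed

text \<open>As \<open>u(\<theta>)\<close> divides \<open>N p\<^sup>k v(\<theta>)\<close>, the exponent \<open>k\<close> bounds its valuation; this makes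
  the repeated extraction of factors \<open>p\<close> terminate.\<close>

lemma eval_int_factor_aux:
  assumes "\<not> p dvd N" "\<not> p dvd poly v m"
    and "eval_int u \<theta> * eval_int w \<theta> = of_int (N * p ^ k) * eval_int v \<theta>"
  shows "\<exists>k x y. \<not> p dvd poly x m \<and> \<not> p dvd poly y m \<and>
    eval_int y \<theta> * eval_int u \<theta> = of_int (p ^ k) * eval_int x \<theta>"
  using assms(2,3)
proof (induction k arbitrary: u v)
  case 0
  \<comment> \<open>For \<open>k = 0\<close> the right-hand side has nonzero residue, hence so does
    \<open>u(\<theta>)\<close>.\<close>
  have "eval_int (u * w - smult N v) \<theta> = 0"
    using 0(2) by simp
  then have "p dvd poly (u * w - smult N v) m"
    by (rule root)
  moreover have "N * poly v m = poly u m * poly w m - poly (u * w - smult N v) m"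
    by simp
  ultimately have "p dvd poly u m \<Longrightarrow> p dvd N * poly v m"
    by (metis dvd_diff dvd_mult2)
  then have "\<not> p dvd poly u m"
    using assms(1) 0(1) by auto
  then show ?case
    by (intro exI[of _ 0] exI[of _ u] exI[of _ 1]) simp
next
  case (Suc k)
  show ?case
  proof (cases "p dvd poly u m")
    case False
    then show ?thesis
      by (intro exI[of _ 0] exI[of _ u] exI[of _ 1]) simp
  next
    case True
    then obtain y z where yz: "\<not> p dvd poly y m"
      "eval_int y \<theta> * eval_int u \<theta> = of_int p * eval_int z \<theta>"
      using dvd_eval_int_local by blast
    have "of_int p * (eval_int z \<theta> * eval_int w \<theta>) =
        eval_int y \<theta> * (eval_int u \<theta> * eval_int w \<theta>)"
      using yz(2) by (simp add: mult.assoc [symmetric])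
    also have "\<dots> = of_int p * (of_int (N * p ^ k) * eval_int (y * v) \<theta>)"
      by (simp add: Suc.prems(2))
    finally have "eval_int z \<theta> * eval_int w \<theta> = of_int (N * p ^ k) * eval_int (y * v) \<theta>"
      by simp
    moreover have "\<not> p dvd poly (y * v) m"
      using yz(1) Suc.prems(1) by simp
    ultimately obtain l x y' where l: "\<not> p dvd poly x m" "\<not> p dvd poly y' m"
      "eval_int y' \<theta> * eval_int z \<theta> = of_int (p ^ l) * eval_int x \<theta>"
      using Suc.IH by blast
    have "eval_int (y' * y) \<theta> * eval_int u \<theta> = of_int p * (eval_int y' \<theta> * eval_int z \<theta>)"
      using yz(2) by (simp add: algebra_simps)
    also have "\<dots> = of_int (p ^ Suc l) * eval_int x \<theta>"
      by (simp add: l(3))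
    finally show ?thesis
      using l(1,2) yz(1)
      by (intro exI[of _ "Suc l"] exI[of _ x] exI[of _ "y' * y"]) simp
  qed
qed

text \<open>Some multiple of \<open>u(\<theta>)\<close> is a nonzero integer \<open>N\<close>;
  splitting \<open>N\<close> into a power of \<open>p\<close> and a factor prime to \<open>p\<close>
  gives the starting exponent for the extraction.\<close>

lemma eval_int_factor:
  assumes "eval_int u \<theta> \<noteq> 0"
  obtains k x y where "\<not> p dvd poly x m" "\<not> p dvd poly y m"
    "eval_int y \<theta> * eval_int u \<theta> = of_int (p ^ k) * eval_int x \<theta>"
proof -
  obtain w N where N: "N \<noteq> 0" "eval_int w \<theta> * eval_int u \<theta> = of_int N"
    using eval_int_multiple_of_int[OF algebraic assms] by blast
  obtain M where M: "N = p ^ multiplicity p N * M" "\<not> p dvd M"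
    using multiplicity_decompose'[of N p] N(1) abs_p_neq_1 by auto
  have "eval_int u \<theta> * eval_int w \<theta> = of_int (M * p ^ multiplicity p N) * eval_int 1 \<theta>"
    using N(2) M(1) by (simp only: mult.commute eval_int_1 mult_1_right mult_1_left)
  moreover have "\<not> p dvd poly 1 m"
    by simp
  ultimately show thesis
    using eval_int_factor_aux[OF M(2)] that by blast
qed

text \<open>Numerator and denominator of \<open>x\<close> are, up to local units, \<open>p^i\<close>
  and \<open>p^j\<close>. For \<open>j \<le> i\<close> the element \<open>x\<close> is integral;
  otherwise its inverse is divisible by \<open>p\<close>.\<close>

lemma red_or_red_inverse:
  assumes "x \<in> simple_ext \<theta>"
  shows "(\<exists>c. red x c) \<or> (\<exists>y. x * y = 1 \<and> red y 0)"
proof (cases "x = 0")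
  case True
  then show ?thesis
    using red_0 by blast
next
  case False
  obtain w l where l: "l \<noteq> 0" "of_int l * x = eval_int w \<theta>"
    using assms by (rule simple_extE)
  have "eval_int w \<theta> \<noteq> 0"
    using l False by (metis mult_eq_0_iff of_int_eq_0_iff)
  then obtain i u v where u: "\<not> p dvd poly u m" "\<not> p dvd poly v m"
    "eval_int v \<theta> * eval_int w \<theta> = of_int (p ^ i) * eval_int u \<theta>"
    by (rule eval_int_factor)
  have "eval_int [:l:] \<theta> \<noteq> 0"
    using l(1) by simp
  then obtain j u' v' where u': "\<not> p dvd poly u' m" "\<not> p dvd poly v' m"
    "eval_int v' \<theta> * eval_int [:l:] \<theta> = of_int (p ^ j) * eval_int u' \<theta>"
    by (rule eval_int_factor)
  have eq: "of_int (p ^ j) * (eval_int (u' * v) \<theta> * x) = of_int (p ^ i) * eval_int (v' * u) \<theta>"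
  proof -
    have u'3: "of_int (p ^ j) * eval_int u' \<theta> = eval_int v' \<theta> * of_int l"
      using u'(3) by simp
    have "of_int (p ^ j) * (eval_int (u' * v) \<theta> * x) =
        (of_int (p ^ j) * eval_int u' \<theta>) * eval_int v \<theta> * x"
      by simp
    also have "\<dots> = eval_int v' \<theta> * (eval_int v \<theta> * (of_int l * x))"
      by (simp only: u'3) (simp only: mult_ac)
    also have "\<dots> = of_int (p ^ i) * eval_int (v' * u) \<theta>"
      by (simp add: l(2) u(3))
    finally show ?thesis .
  qed
  show ?thesis
  proof (cases "j \<le> i")
    case True
    then obtain k where k: "i = j + k"
      using le_Suc_ex by blast
    have "eval_int (u' * v) \<theta> * x = eval_int (smult (p ^ k) (v' * u)) \<theta>"
      using eq by (simp add: k power_add mult.assoc)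
    moreover have "\<not> p dvd poly (u' * v) m"
      using u' u by simp
    ultimately show ?thesis
      using ex_red by blast
  next
    case False
    then obtain k where k: "j = i + Suc k"
      using less_imp_Suc_add[of i j] by auto
    have "of_int (p ^ Suc k) * (eval_int (u' * v) \<theta> * x) = eval_int (v' * u) \<theta>"
      using eq by (simp add: k power_add mult.assoc)
    then have "eval_int (v' * u) \<theta> * inverse x =
        of_int (p ^ Suc k) * (eval_int (u' * v) \<theta> * x) * inverse x"
      by (simp only:)
    also have "\<dots> = eval_int (smult (p ^ Suc k) (u' * v)) \<theta>"
      using \<open>x \<noteq> 0\<close> by (simp add: mult.assoc)
    finally have "eval_int (v' * u) \<theta> * inverse x = eval_int (smult (p ^ Suc k) (u' * v)) \<theta>" .
    then have "red (inverse x) 0"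
      using u(1) u'(2) by (intro redI[of "v' * u" _ "smult (p ^ Suc k) (u' * v)"]) auto
    then show ?thesis
      using \<open>x \<noteq> 0\<close> by (intro disjI2 exI[of _ "inverse x"]) simp
  qed
qed

text \<open>If \<open>x\<close> had no residue, \<open>y = 1/x\<close> would have residue 0.
  Multiplying the equation by \<open>y^d\<close> and reducing would then leave only the leading
  coefficient, which is a unit.\<close>

lemma red_root:
  assumes x: "x \<in> simple_ext \<theta>" and eq: "(\<Sum>j\<le>d. b j * x ^ j) = 0"
    and b: "\<And>j. j \<le> d \<Longrightarrow> red (b j) (c j)" and "\<not> p dvd c d"
  obtains t where "red x t" "p dvd (\<Sum>j\<le>d. c j * t ^ j)"
proof -
  have "\<exists>t. red x t"
  proof (rule ccontr)
    assume "\<nexists>t. red x t"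
    then obtain y where y: "x * y = 1" "red y 0"
      using red_or_red_inverse[OF x] by blast
    have "red (\<Sum>j\<le>d. b j * y ^ (d - j)) (\<Sum>j\<le>d. c j * 0 ^ (d - j))"
      using b y(2) by (intro red_sum red_mult red_power) auto
    moreover have "(\<Sum>j\<le>d. b j * y ^ (d - j)) = y ^ d * (\<Sum>j\<le>d. b j * x ^ j)"
      unfolding sum_distrib_left
    proof (rule sum.cong)
      fix j assume "j \<in> {..d}"
      then have "y ^ d = y ^ (d - j) * y ^ j"
        by (simp flip: power_add)
      then have "y ^ d * (b j * x ^ j) = b j * y ^ (d - j) * (x * y) ^ j"
        by (simp add: power_mult_distrib)
      then show "b j * y ^ (d - j) = y ^ d * (b j * x ^ j)"
        by (simp only: y(1) power_one mult_1_right)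
    qed simp
    \<comment> \<open>Only \<open>j = d\<close> survives, because \<open>0 ^ 0 = 1\<close>.\<close>
    moreover have "(\<Sum>j\<le>d. c j * 0 ^ (d - j)) = c d"
      by (subst sum.remove[of _ d]) (auto intro!: sum.neutral)
    ultimately have "red 0 (c d)"
      by (simp add: eq)
    then show False
      using red_unique[of 0 "c d" 0] \<open>\<not> p dvd c d\<close> by simp
  qed
  then obtain t where t: "red x t"
    by blast
  then have "red (\<Sum>j\<le>d. b j * x ^ j) (\<Sum>j\<le>d. c j * t ^ j)"
    using b by (intro red_sum red_mult red_power) auto
  then have "p dvd (\<Sum>j\<le>d. c j * t ^ j)"
    using red_unique[of 0 "\<Sum>j\<le>d. c j * t ^ j" 0] eq by simp
  then show thesis
    using t that by blast
qed

end

text \<open>Take a prime \<open>p\<close> and a root \<open>m\<close> modulo \<open>p\<close> of a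
  least-degree polynomial \<open>h\<close> of \<theta>, with \<open>p\<close> prime to a suitable
  \<open>D\<close>. Then \<theta> can be sent to \<open>m\<close>, and \<open>m\<close> is a simple
  root.\<close>

lemma degree_one_place_exists:
  fixes \<theta> :: "'a::field_char_0"
  assumes alg: "\<And>w. algebraic (eval_int w \<theta>)"
    and S: "finite S" "S \<subseteq> simple_ext \<theta>"
  shows "\<exists>p m. degree_one_place \<theta> p m \<and>
    (\<forall>s\<in>S. \<exists>c. degree_one_place.red \<theta> p m s c \<and> (s \<noteq> 0 \<longrightarrow> \<not> p dvd c))"
proof -
  have "algebraic \<theta>"
    using alg[of "[:0, 1:]"] by simp
  then obtain h where h: "h \<noteq> 0" "eval_int h \<theta> = 0" and deg_h: "degree h > 0"
    and "eval_int (pderiv h) \<theta> \<noteq> 0"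
    and least: "\<And>w. w \<noteq> 0 \<Longrightarrow> eval_int w \<theta> = 0 \<Longrightarrow> degree h \<le> degree w"
    using algebraic_least_polyE[of \<theta>] by (metis (no_types, lifting))
  then obtain h' N where N: "N \<noteq> 0" "eval_int h' \<theta> * eval_int (pderiv h) \<theta> = of_int N"
    using eval_int_multiple_of_int[OF alg] by blast
  have "\<exists>k u M w. s \<noteq> 0 \<longrightarrow> k \<noteq> 0 \<and> M \<noteq> 0 \<and> of_int k * s = eval_int u \<theta> \<and>
      eval_int w \<theta> * eval_int u \<theta> = of_int M" if s: "s \<in> S" for s
  proof (cases "s = 0")
    case False
    obtain u k where u: "k \<noteq> 0" "of_int k * s = eval_int u \<theta>"
      using subsetD[OF S(2) s] by (rule simple_extE)
    then have "eval_int u \<theta> \<noteq> 0"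
      using False by (metis mult_eq_0_iff of_int_eq_0_iff)
    then show ?thesis
      using eval_int_multiple_of_int[OF alg] u by metis
  qed simp
  then obtain k u M w where kM: "\<And>s. s \<in> S \<Longrightarrow> s \<noteq> 0 \<Longrightarrow> k s \<noteq> (0::int) \<and> M s \<noteq> (0::int) \<and>
      of_int (k s) * s = eval_int (u s) \<theta> \<and> eval_int (w s) \<theta> * eval_int (u s) \<theta> = of_int (M s)"
    by metis
  \<comment> \<open>The leading coefficient of \<open>h\<close> is needed for pseudo-division,
    \<open>N\<close> for simplicity of the root \<open>m\<close>, and the \<open>k s\<close> and
    \<open>M s\<close> make the nonzero elements of \<open>S\<close> local units.\<close>
  define D where "D = lead_coeff h * N * (\<Prod>s\<in>S - {0}. k s * M s)"
  have "D \<noteq> 0"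
    using h(1) N(1) kM S(1) by (auto simp: D_def)
  then obtain p m where p: "prime p" "\<not> p dvd D" "p dvd poly h m"
    using prime_dividing_value_avoiding[OF deg_h] by metis
  have p_D: "\<not> p dvd lead_coeff h" "\<not> p dvd N"
    "\<And>s. s \<in> S \<Longrightarrow> s \<noteq> 0 \<Longrightarrow> \<not> p dvd k s \<and> \<not> p dvd M s"
    using p(2) prime_dvd_mult_iff[OF p(1)] S(1)
    by (auto simp: D_def prime_dvd_prod_iff[OF _ p(1)])
  \<comment> \<open>Pseudo-division keeps the coefficients integral; minimality of \<open>h\<close>
    forces the remainder to vanish.\<close>
  have root: "p dvd poly v m" if v: "eval_int v \<theta> = 0" for v
  proof -
    obtain q r where qr: "pseudo_divmod v h = (q, r)"
      by force
    define e where "e = Suc (degree v) - degree h"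
    have eq: "smult (lead_coeff h ^ e) v = h * q + r" and r: "r = 0 \<or> degree r < degree h"
      using pseudo_divmod[OF h(1) qr] by (auto simp: e_def)
    have "eval_int (smult (lead_coeff h ^ e) v) \<theta> = eval_int (h * q + r) \<theta>"
      by (simp only: eq)
    then have "eval_int r \<theta> = 0"
      using h(2) v by simp
    then have "r = 0"
      using r least[of r] by fastforce
    then have "lead_coeff h ^ e * poly v m = poly h m * poly q m"
      using arg_cong[OF eq, of "\<lambda>w. poly w m"] by simp
    then have "p dvd lead_coeff h ^ e * poly v m"
      using p(3) by simp
    then show ?thesis
      using p_D(1) p(1) by (auto simp: prime_dvd_mult_iff dest: prime_dvd_power)
  qed
  have dvd_eq: "p dvd poly v m - c" if "eval_int v \<theta> = of_int c" for v c
    using root[of "v - [:c:]"] that by simp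
  have place: "degree_one_place \<theta> p m"
  proof
    \<comment> \<open>As \<open>h = (X - m) g + h(m)\<close>, the derivative of \<open>h\<close> at
      \<open>m\<close> is \<open>g(m)\<close>, a unit modulo \<open>p\<close> because
      \<open>p\<close> does not divide \<open>N\<close>; and
      \<open>g(\<theta>) (\<theta> - m) = - h(m)\<close> is a multiple of \<open>p\<close>.\<close>
    define g where "g = synthetic_div h m"
    have hg: "h = [:-m, 1:] * g + [:poly h m:]"
      by (simp only: g_def synthetic_div_correct')
    have "poly (pderiv h) m = poly g m"
      by (subst hg) (simp add: pderiv_add pderiv_mult pderiv_pCons del: mult_pCons_left)
    moreover have "p dvd poly (h' * pderiv h) m - N"
      using N(2) by (intro dvd_eq) simp
    ultimately have "\<not> p dvd poly g m"
      using p_D(2) by (metis dvd_diff_right_iff dvd_mult poly_mult)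
    moreover have "eval_int g \<theta> * (\<theta> - of_int m) = of_int (- poly h m)"
      using h(2) arg_cong[OF hg, of "\<lambda>w. eval_int w \<theta>"] by (simp add: algebra_simps add_eq_0_iff2)
    moreover obtain b where "poly h m = p * b"
      using p(3) by (elim dvdE)
    ultimately show "\<exists>g c. \<not> p dvd poly g m \<and> eval_int g \<theta> * (\<theta> - of_int m) = of_int (p * c)"
      by (intro exI[of _ g] exI[of _ "- b"]) simp
  qed (use p(1) root alg in auto)
  interpret degree_one_place \<theta> p m
    by (rule place)
  have "\<exists>c. red s c \<and> (s \<noteq> 0 \<longrightarrow> \<not> p dvd c)" if s: "s \<in> S" for s
  proof (cases "s = 0")
    case False
    have "\<exists>c. red s c"
      using kM[OF s False] p_D(3)[OF s False] by (intro ex_red[of "[:k s:]" _ "u s"]) auto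
    then obtain c where c: "red s c"
      by blast
    have "red (of_int (k s) * s) (k s * c)"
      using c by (intro red_mult) simp_all
    moreover have "red (eval_int (u s) \<theta>) (poly (u s) m)"
      by (rule redI[of 1 _ "u s"]) simp_all
    ultimately have "p dvd k s * c - poly (u s) m"
      using red_unique kM[OF s False] by metis
    moreover have "p dvd poly (w s * u s) m - M s"
      using kM[OF s False] by (intro dvd_eq) simp
    \<comment> \<open>If \<open>p\<close> divided \<open>c\<close>, it would divide
      \<open>u s\<close> at \<open>m\<close>, and therefore \<open>M s\<close>.\<close>
    ultimately have "\<not> p dvd c"
      using p_D(3)[OF s False] by (metis dvd_diff_right_iff dvd_diff_left_iff dvd_mult poly_mult)
    then show ?thesis
      using c by blast
  next
    case True
    then show ?thesis
      using red_0 by blast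
  qed
  with place show ?thesis
    by blast
qed

subsection \<open>Embedding the field\<close>

lemma to_ac_of_rat: "to_ac (of_rat q :: 'k::field_char_0) = of_rat q"
proof -
  obtain a b where "quotient_of q = (a, b)" by force
  then have "q = of_int a / of_int b"
    by (rule quotient_of_div)
  then show ?thesis
    by (simp add: of_rat_divide)
qed

lemma map_poly_to_ac_add: "map_poly to_ac (v + w) = map_poly to_ac v + map_poly to_ac w"
  by (rule poly_eqI) (simp add: coeff_map_poly)

lemma poly_map_to_ac_mult:
  "poly (map_poly to_ac (v * w)) x = poly (map_poly to_ac v) x * poly (map_poly to_ac w) x"
proof (induction v)
  case (pCons a v)
  have "map_poly to_ac (smult a w) = smult (to_ac a) (map_poly to_ac w)"
    by (rule poly_eqI) (simp add: coeff_map_poly)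
  with pCons show ?case
    by (simp add: map_poly_to_ac_add map_poly_pCons algebra_simps)
qed simp

text \<open>\<beta> is a root of a nonzero polynomial \<open>r\<close> over the field
  \<open>'k\<close>. Reduction modulo \<open>r\<close> bounds the powers of \<beta>, and a rational
  basis of \<open>'k\<close> spans the coefficients.\<close>

lemma adjunction_span:
  fixes \<beta> :: "'k::field_char_0 alg_closure"
  assumes "finite_extension_of_rat TYPE('k)"
  obtains B where "finite B" "\<And>w :: 'k poly. poly (map_poly to_ac w) \<beta> \<in> rat_vs.span B"
proof -
  obtain B0 :: "'k set" where B0: "finite_dimensional_vector_space rat_scale B0"
    using assms by (auto simp: finite_extension_of_rat_def)
  have fin: "finite B0" and span: "rat_vs.span B0 = (UNIV :: 'k set)"
    using B0 by (simp_all add: finite_dimensional_vector_space.finite_Basis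
        finite_dimensional_vector_space.span_Basis)
  obtain r :: "'k poly" where r: "r \<noteq> 0" "poly (map_poly to_ac r) \<beta> = 0"
    using alg_closure_algebraic by blast
  define B where "B = (\<lambda>(b, j). to_ac b * \<beta> ^ j) ` (B0 \<times> {..degree r})"
  have monomial: "to_ac x * \<beta> ^ j \<in> rat_vs.span B" if "j \<le> degree r" for x j
  proof -
    have "x \<in> rat_vs.span B0"
      by (simp add: span)
    then show ?thesis
    proof (induction rule: rat_vs.span_induct_alt)
      case base
      show ?case
        by (simp add: rat_vs.span_zero)
    next
      case (step q b y)
      have "to_ac b * \<beta> ^ j \<in> rat_vs.span B"
        using step(1) that by (intro rat_vs.span_base) (auto simp: B_def)
      then have "rat_scale q (to_ac b * \<beta> ^ j) + to_ac y * \<beta> ^ j \<in> rat_vs.span B"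
        by (intro rat_vs.span_add rat_vs.span_scale step)
      moreover have "rat_scale q (to_ac b * \<beta> ^ j) + to_ac y * \<beta> ^ j = to_ac (rat_scale q b + y) * \<beta> ^ j"
        by (simp add: rat_scale_def to_ac_of_rat algebra_simps)
      ultimately show ?case
        by (simp only:)
    qed
  qed
  have "poly (map_poly to_ac w) \<beta> \<in> rat_vs.span B" for w
  proof -
    have "map_poly to_ac w = map_poly to_ac (r * (w div r) + w mod r)"
      by simp
    then have "poly (map_poly to_ac w) \<beta> = poly (map_poly to_ac (w mod r)) \<beta>"
      using r(2) by (simp only: map_poly_to_ac_add poly_map_to_ac_mult poly_add) simp
    also have "\<dots> = (\<Sum>j\<le>degree (map_poly to_ac (w mod r)). to_ac (coeff (w mod r) j) * \<beta> ^ j)"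
      by (simp add: poly_altdef coeff_map_poly)
    also have "\<dots> \<in> rat_vs.span B"
    proof (intro rat_vs.span_sum monomial)
      fix j assume "j \<in> {..degree (map_poly to_ac (w mod r))}"
      then have "j \<le> degree (w mod r)"
        using map_poly_degree_leq[of to_ac "w mod r"] by auto
      then show "j \<le> degree r"
        using degree_mod_less_degree[of w r] degree_mod_less[of r w] r(1) by auto
    qed
    finally show ?thesis .
  qed
  moreover have "finite B"
    using fin by (simp add: B_def)
  ultimately show thesis
    using that by blast
qed

text \<open>The ring \<open>L\<close>, generated by \<beta> over the image of \<open>'k\<close>,
  lies in a finite-dimensional rational space. So its elements are algebraic and primitive elements
  are available inside it.\<close>

lemma degree_one_place_of_field:
  fixes \<beta> :: "'k::field_char_0 alg_closure" and S :: "'k set"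
  assumes ext: "finite_extension_of_rat TYPE('k)" and "finite S"
  shows "\<exists>\<theta> p m. degree_one_place \<theta> p m \<and> range (to_ac :: 'k \<Rightarrow> _) \<subseteq> simple_ext \<theta> \<and>
    (\<forall>s\<in>insert \<beta> (to_ac ` S).
      \<exists>c. degree_one_place.red \<theta> p m s c \<and> (s \<noteq> 0 \<longrightarrow> \<not> p dvd c))"
proof -
  define L where "L = range (\<lambda>w :: 'k poly. poly (map_poly to_ac w) \<beta>)"
  have LI: "poly (map_poly to_ac w) \<beta> \<in> L" for w
    by (simp add: L_def)
  obtain B where B: "finite B" "\<And>w :: 'k poly. poly (map_poly to_ac w) \<beta> \<in> rat_vs.span B"
    using adjunction_span[OF ext, of \<beta>] by metis
  have L_span: "L \<subseteq> rat_vs.span B"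
    using B(2) by (auto simp: L_def)
  obtain B0 :: "'k set" where B0: "finite_dimensional_vector_space rat_scale B0"
    using ext by (auto simp: finite_extension_of_rat_def)
  have fin: "finite B0" and span: "rat_vs.span B0 = (UNIV :: 'k set)"
    using B0 by (simp_all add: finite_dimensional_vector_space.finite_Basis
        finite_dimensional_vector_space.span_Basis)
  have L_add: "x + y \<in> L" if xy: "x \<in> L" "y \<in> L" for x y
  proof -
    obtain v w where "x = poly (map_poly to_ac v) \<beta>" "y = poly (map_poly to_ac w) \<beta>"
      using xy by (auto simp: L_def)
    then show ?thesis
      using LI[of "v + w"] by (simp add: map_poly_to_ac_add)
  qed
  have L_mult: "x * y \<in> L" if xy: "x \<in> L" "y \<in> L" for x y
  proof -
    obtain v w where "x = poly (map_poly to_ac v) \<beta>" "y = poly (map_poly to_ac w) \<beta>"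
      using xy by (auto simp: L_def)
    then show ?thesis
      using LI[of "v * w"] by (simp add: poly_map_to_ac_mult)
  qed
  have L_to_ac: "to_ac x \<in> L" for x
    using LI[of "[:x:]"] by (simp add: map_poly_pCons)
  have L_int: "of_int k \<in> L" for k
    using L_to_ac[of "of_int k"] by simp
  have "\<beta> \<in> L"
    using LI[of "[:0, 1:]"] by (simp add: map_poly_pCons)
  have L_power: "x ^ k \<in> L" if "x \<in> L" for x k
    using that L_int[of 1] by (induction k) (simp_all add: L_mult)
  have L_alg: "algebraic x" if "x \<in> L" for x
    using B(1) L_span L_power[OF that] by (intro algebraic_if_powers_in_span[of B]) auto
  \<comment> \<open>Including the basis \<open>B0\<close> places the whole image of
    \<open>'k\<close> in \<open>simple_ext \<theta>\<close>.\<close>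
  have "finite (insert \<beta> (to_ac ` (B0 \<union> S)))" "insert \<beta> (to_ac ` (B0 \<union> S)) \<subseteq> L"
    using fin \<open>finite S\<close> \<open>\<beta> \<in> L\<close> L_to_ac by auto
  then have "\<exists>\<theta>\<in>L. insert \<beta> (to_ac ` (B0 \<union> S)) \<subseteq> simple_ext \<theta>"
    by (intro primitive_element) (auto intro: L_add L_mult L_int L_alg)
  then obtain \<theta> where \<theta>: "\<theta> \<in> L" "insert \<beta> (to_ac ` (B0 \<union> S)) \<subseteq> simple_ext \<theta>"
    by blast
  have "eval_int w \<theta> \<in> L" for w
    by (induction w) (use L_int[of 0] in \<open>auto intro!: L_add L_mult L_int \<theta>\<close>)
  then have alg: "algebraic (eval_int w \<theta>)" for w
    by (intro L_alg)
  have "to_ac x \<in> simple_ext \<theta>" for x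
  proof -
    have "x \<in> rat_vs.span B0"
      by (simp add: span)
    then show ?thesis
    proof (induction rule: rat_vs.span_induct_alt)
      case (step q b y)
      then show ?case
        using \<theta>(2) by (auto simp: rat_scale_def to_ac_of_rat intro!: simple_ext_add simple_ext_mult simple_ext_of_rat)
    qed simp
  qed
  then have to_ac: "range (to_ac :: 'k \<Rightarrow> _) \<subseteq> simple_ext \<theta>"
    by auto
  have "finite (insert \<beta> (to_ac ` S))" "insert \<beta> (to_ac ` S) \<subseteq> simple_ext \<theta>"
    using \<open>finite S\<close> \<theta>(2) by auto
  from degree_one_place_exists[OF alg this] show ?thesis
    using to_ac by blast
qed

subsection \<open>Integer coefficients avoiding roots\<close>

text \<open>By \<open>cong\<close>, the map \<open>- G\<close> acts on the finite set of residues
  modulo \<open>p\<close>, where surjectivity implies injectivity.\<close>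

lemma inj_mod_if_surj_mod:
  fixes G :: "int \<Rightarrow> int"
  assumes "p > 0" and cong: "\<And>s t. p dvd s - t \<Longrightarrow> p dvd G s - G t"
    and surj: "\<And>n. n \<noteq> 0 \<Longrightarrow> \<exists>t. p dvd n + G t"
    and "p dvd G s - G t"
  shows "p dvd s - t"
proof -
  define f where "f = (\<lambda>t. - G t mod p)"
  have "{0..<p} \<subseteq> f ` {0..<p}"
  proof
    fix c assume c: "c \<in> {0..<p}"
    \<comment> \<open>The class of \<open>c\<close> is represented by \<open>c + p\<close>, which is
      nonzero even for \<open>c = 0\<close>.\<close>
    then obtain t where t: "p dvd (c + p) + G t"
      using surj[of "c + p"] by auto
    have "p dvd t mod p - t"
      by (metis dvd_minus_mod dvd_minus_iff minus_diff_eq)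
    then have "p dvd ((c + p) + G t) + (G (t mod p) - G t)"
      by (rule dvd_add[OF t cong])
    then have "p dvd ((c + p) + G t) + (G (t mod p) - G t) - p"
      by (intro dvd_diff) auto
    then have "p dvd c - - G (t mod p)"
      by simp
    then have "c mod p = - G (t mod p) mod p"
      by (simp add: mod_eq_dvd_iff)
    then have "c = f (t mod p)"
      using c by (simp add: f_def)
    then show "c \<in> f ` {0..<p}"
      using \<open>p > 0\<close> by auto
  qed
  then have inj: "inj_on f {0..<p}"
    by (intro finite_surj_inj) auto
  have f_mod: "f (u mod p) = - G u mod p" for u
  proof -
    have "p dvd u - u mod p"
      by (rule dvd_minus_mod)
    then have "p dvd - G (u mod p) - - G u"
      using cong[of u "u mod p"] by simp
    then show ?thesis
      by (simp add: f_def mod_eq_dvd_iff)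
  qed
  have "- G s mod p = - G t mod p"
    using assms(4) by (simp add: mod_eq_dvd_iff dvd_diff_commute[of p "G t" "G s"])
  then have "f (s mod p) = f (t mod p)"
    by (simp only: f_mod)
  then have "s mod p = t mod p"
    using inj \<open>p > 0\<close> by (auto dest: inj_onD)
  then show ?thesis
    by (simp add: mod_eq_dvd_iff)
qed

text \<open>A unit \<open>t\<close> determines the class of \<open>n\<close> in
  \<open>n t^i + G t = 0\<close> modulo \<open>p\<close>. Choosing a solution for each class would
  thus inject \<open>p\<close> classes into \<open>p - 1\<close> nonzero residues.\<close>

lemma not_surj_mod_from_units:
  fixes G :: "int \<Rightarrow> int"
  assumes "prime p" and cong: "\<And>s t. p dvd s - t \<Longrightarrow> p dvd G s - G t"
    and surj: "\<And>n. n \<noteq> 0 \<Longrightarrow> \<exists>t. \<not> p dvd t \<and> p dvd n * t ^ i + G t"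
  shows False
proof -
  have "p > 0"
    using \<open>prime p\<close> by (rule prime_gt_0_int)
  obtain T where T: "\<And>n. n \<noteq> 0 \<Longrightarrow> \<not> p dvd T n \<and> p dvd n * T n ^ i + G (T n)"
    using surj by metis
  define f where "f = (\<lambda>c. T (c + p) mod p)"
  have "inj_on f {0..<p}"
  proof (rule inj_onI)
    fix b c assume b: "b \<in> {0..<p}" and c: "c \<in> {0..<p}" and "f b = f c"
    define s where "s = T (b + p)"
    define t where "t = T (c + p)"
    have s: "p dvd (b + p) * s ^ i + G s" and t: "\<not> p dvd t" "p dvd (c + p) * t ^ i + G t"
      using T[of "b + p"] T[of "c + p"] b c by (auto simp: s_def t_def)
    have "p dvd s - t"
      using \<open>f b = f c\<close> by (simp add: f_def s_def t_def mod_eq_dvd_iff)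
    then have dvd: "p dvd G s - G t" "p dvd (b + p) * (s ^ i - t ^ i)"
      using cong power_diff_sumr2[of s i t] by (auto intro: dvd_mult2)
    \<comment> \<open>In the difference of the two congruences \<open>s\<close> is replaced by
      \<open>t\<close>, which leaves \<open>(b - c) t^i\<close>.\<close>
    have "p dvd ((b + p) * s ^ i + G s) - ((c + p) * t ^ i + G t) - (G s - G t)
        - (b + p) * (s ^ i - t ^ i)"
      by (intro dvd_diff[OF dvd_diff[OF dvd_diff]] s t dvd)
    also have "\<dots> = (b - c) * t ^ i"
      by (simp add: algebra_simps)
    finally have "p dvd b - c"
      using t(1) \<open>prime p\<close> by (auto simp: prime_dvd_mult_iff dest: prime_dvd_power)
    then have "b mod p = c mod p"
      by (simp add: mod_eq_dvd_iff)
    then show "b = c"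
      using b c by simp
  qed
  moreover have "f ` {0..<p} \<subseteq> {1..<p}"
  proof
    fix y assume "y \<in> f ` {0..<p}"
    then obtain c where c: "c \<in> {0..<p}" "y = T (c + p) mod p"
      by (auto simp: f_def)
    then have "T (c + p) mod p \<noteq> 0"
      using T[of "c + p"] by (auto simp: dvd_eq_mod_eq_0)
    moreover have "0 \<le> T (c + p) mod p" "T (c + p) mod p < p"
      using \<open>p > 0\<close> by simp_all
    ultimately show "y \<in> {1..<p}"
      using c(2) by simp
  qed
  ultimately have "card {0..<p} \<le> card {1..<p}"
    by (intro card_inj_on_le) auto
  then show False
    using \<open>p > 0\<close> by simp
qed

text \<open>Choose \<open>n\<close> outside the roots of the derivative and write
  \<open>f - f(n) = (X - n) q\<close>. Then \<open>q(n) = f'(n) \<noteq> 0\<close>, so any root of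
  the nonconstant \<open>q\<close> differs from \<open>n\<close>.\<close>

lemma poly_not_injective_at_int:
  fixes f :: "'a::{field_char_0, alg_closed_field} poly"
  assumes "degree f \<ge> 2"
  obtains n :: int and \<beta> where "\<beta> \<noteq> of_int n" "poly f \<beta> = poly f (of_int n)"
proof -
  have "pderiv f \<noteq> 0"
    using assms by (simp add: pderiv_eq_0_iff)
  then have "finite ((of_int :: int \<Rightarrow> 'a) -` {x. poly (pderiv f) x = 0})"
    by (intro finite_vimageI poly_roots_finite) (auto simp: inj_on_def)
  then obtain n :: int where n: "poly (pderiv f) (of_int n) \<noteq> 0"
    using infinite_UNIV_int ex_new_if_finite by blast
  define q where "q = synthetic_div f (of_int n)"
  have f: "f = [:- of_int n, 1:] * q + [:poly f (of_int n):]"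
    by (simp only: q_def synthetic_div_correct')
  have "degree q > 0"
    using assms by (simp add: q_def degree_synthetic_div)
  then obtain \<beta> where \<beta>: "poly q \<beta> = 0"
    using alg_closed_imp_poly_has_root by blast
  have "poly (pderiv f) (of_int n) = poly q (of_int n)"
    by (subst f) (simp add: pderiv_add pderiv_mult pderiv_pCons del: mult_pCons_left)
  then have "\<beta> \<noteq> of_int n"
    using n \<beta> by auto
  moreover have "poly f \<beta> = poly f (of_int n)"
    using arg_cong[OF f, of "\<lambda>w. poly w \<beta>"] \<beta> by simp
  ultimately show thesis
    by (rule that)
qed

lemma ex_int_coeff_without_root:
  fixes a :: "nat \<Rightarrow> 'k::field_char_0"
  assumes ext: "finite_extension_of_rat TYPE('k)" and "d \<ge> 2" and "i < d"
    and a_0: "i \<noteq> 0 \<Longrightarrow> a 0 \<noteq> 0" and a_d: "a d \<noteq> 0"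
  shows "\<exists>n::int. n \<noteq> 0 \<and> (\<forall>x. (\<Sum>j\<le>d. (if j = i then of_int n else a j) * x ^ j) \<noteq> 0)"
proof (rule ccontr)
  assume "\<not> ?thesis"
  then have ex_root: "\<exists>x. (\<Sum>j\<le>d. (if j = i then of_int n else a j) * x ^ j) = 0" if "n \<noteq> 0" for n
    using that by blast
  define J where "J = {..d} - {i}"
  define f where "f = (\<Sum>j\<in>J. monom (to_ac (a j)) j)"
  have poly_f: "poly f x = (\<Sum>j\<in>J. to_ac (a j) * x ^ j)" for x
    by (simp add: f_def poly_sum poly_monom)
  have "coeff f d \<noteq> 0"
    using a_d \<open>i < d\<close> by (simp add: f_def coeff_sum J_def)
  then have "degree f \<ge> 2"
    using le_degree[of f d] \<open>d \<ge> 2\<close> by linarith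
  \<comment> \<open>\<beta> is fixed before the place, because the place has to make
    \<open>\<beta> - y\<close> a unit.\<close>
  then obtain y :: int and \<beta> where \<beta>: "\<beta> \<noteq> of_int y" "poly f \<beta> = poly f (of_int y)"
    by (rule poly_not_injective_at_int)
  have "finite (a ` {..d})"
    by simp
  from degree_one_place_of_field[OF ext this, of "\<beta> - of_int y"]
  obtain \<theta> p m where "degree_one_place \<theta> p m" and \<theta>: "range (to_ac :: 'k \<Rightarrow> _) \<subseteq> simple_ext \<theta>"
    and place: "\<forall>s\<in>insert (\<beta> - of_int y) (to_ac ` a ` {..d}).
      \<exists>c. degree_one_place.red \<theta> p m s c \<and> (s \<noteq> 0 \<longrightarrow> \<not> p dvd c)"
    by (elim exE conjE)
  interpret degree_one_place \<theta> p m by fact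
  have "\<forall>j. \<exists>c. j \<le> d \<longrightarrow> red (to_ac (a j)) c \<and> (a j \<noteq> 0 \<longrightarrow> \<not> p dvd c)"
    using place by simp
  then obtain c where c: "\<And>j. j \<le> d \<Longrightarrow> red (to_ac (a j)) (c j)"
    and c_unit: "\<And>j. j \<le> d \<Longrightarrow> a j \<noteq> 0 \<Longrightarrow> \<not> p dvd c j"
    by metis
  define G where "G t = (\<Sum>j\<in>J. c j * t ^ j)" for t
  have cong: "p dvd G s - G t" if "p dvd s - t" for s t
    unfolding G_def sum_subtractf [symmetric] right_diff_distrib [symmetric]
  proof (rule dvd_sum)
    fix j
    have "s - t dvd s ^ j - t ^ j"
      by (simp add: power_diff_sumr2)
    then show "p dvd c j * (s ^ j - t ^ j)"
      using that dvd_trans by (intro dvd_mult) blast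
  qed
  have red_f: "red (poly f x) (G t)" if "red x t" for x t
    unfolding poly_f G_def using c that by (intro red_sum red_mult red_power) (auto simp: J_def)
  \<comment> \<open>As \<open>i < d\<close>, the leading coefficient is \<open>a d\<close>, a unit
    at the place; so the root in \<open>'k\<close> has a residue.\<close>
  have ex_t: "\<exists>t. p dvd n * t ^ i + G t" if "n \<noteq> 0" for n
  proof -
    from ex_root[OF that] obtain x where "(\<Sum>j\<le>d. (if j = i then of_int n else a j) * x ^ j) = 0"
      by blast
    then have "to_ac (\<Sum>j\<le>d. (if j = i then of_int n else a j) * x ^ j) = 0"
      by (simp only: to_ac_0)
    then have "(\<Sum>j\<le>d. to_ac (if j = i then of_int n else a j) * to_ac x ^ j) = 0"
      by (simp add: to_ac_sum)
    then obtain t where "p dvd (\<Sum>j\<le>d. (if j = i then n else c j) * t ^ j)"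
      by (rule red_root[where c = "\<lambda>j. if j = i then n else c j", rotated])
         (use c c_unit a_d \<theta> \<open>i < d\<close> in auto)
    moreover have "(\<Sum>j\<le>d. (if j = i then n else c j) * t ^ j) = n * t ^ i + G t"
      using \<open>i < d\<close> by (subst sum.remove[of _ i]) (auto simp: G_def J_def intro!: sum.cong)
    ultimately show ?thesis
      by auto
  qed
  show False
  proof (cases "i = 0")
    case True
    obtain e where e: "red (\<beta> - of_int y) e" "\<not> p dvd e"
      using place \<beta>(1) by auto
    then have "red \<beta> (e + y)"
      using red_add[OF e(1) red_of_int[of y]] by simp
    \<comment> \<open>Equal values of \<open>f\<close> at \<beta> and \<open>y\<close> reduce to
      equal residues of \<open>G\<close> at \<open>e + y\<close> and \<open>y\<close>, two different
      classes.\<close>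
    then have eq: "p dvd G (e + y) - G y"
      using red_f[of \<beta> "e + y"] red_f[of "of_int y" y] \<beta>(2) red_unique by auto
    have "p dvd (e + y) - y"
    proof (rule inj_mod_if_surj_mod)
      show "p dvd G s - G t" if "p dvd s - t" for s t
        using that by (rule cong)
      show "\<exists>t. p dvd n + G t" if "n \<noteq> 0" for n
        using ex_t[OF that] True by simp
    qed (use prime_gt_0_int[OF prime] eq in auto)
    then show False
      using e(2) by simp
  next
    case False
    \<comment> \<open>A solution divisible by \<open>p\<close> would make the constant term
      \<open>c 0\<close> divisible by \<open>p\<close>, although \<open>a 0\<close> is
      nonzero.\<close>
    have unit: "\<not> p dvd t" if t: "p dvd n * t ^ i + G t" for n t
    proof
      assume "p dvd t"
      then have "p dvd G t - G 0" "p dvd n * t ^ i"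
        using cong[of t 0] False dvd_trans[OF _ dvd_power[of i t]] by auto
      then have "p dvd (n * t ^ i + G t) - (G t - G 0) - n * t ^ i"
        by (intro dvd_diff[OF dvd_diff] t)
      moreover have "G 0 = c 0"
        unfolding G_def using False by (subst sum.remove[of _ 0]) (auto simp: J_def intro!: sum.neutral)
      ultimately show False
        using c_unit[of 0] a_0 False by simp
    qed
    show False
    proof (rule not_surj_mod_from_units[OF prime])
      show "p dvd G s - G t" if "p dvd s - t" for s t
        using that by (rule cong)
      show "\<exists>t. \<not> p dvd t \<and> p dvd n * t ^ i + G t" if "n \<noteq> 0" for n
        using ex_t[OF that] unit by blast
    qed
  qed
qed

theorem theorem5p2:
  fixes a :: "nat \<Rightarrow> 'k::field_char_0" and d i :: nat
  assumes "finite_extension_of_rat TYPE('k)"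
    and "d \<ge> 2" and "i \<le> d"
    and "i \<noteq> 0 \<Longrightarrow> a 0 \<noteq> 0"
    and "i \<noteq> d \<Longrightarrow> a d \<noteq> 0"
  shows "\<exists>n::int. n \<noteq> 0 \<and>
           \<not> (\<exists>x::'k. poly (\<Sum>j\<le>d. monom (if j = i then of_int n else a j) j) x = 0)"
proof (cases "i = d")
  case False
  then have "\<exists>n::int. n \<noteq> 0 \<and> (\<forall>x. (\<Sum>j\<le>d. (if j = i then of_int n else a j) * x ^ j) \<noteq> 0)"
    using assms by (intro ex_int_coeff_without_root) auto
  then show ?thesis
    by (simp add: poly_sum poly_monom)
next
  case True
  \<comment> \<open>For \<open>i = d\<close> the reversed coefficients have the free one in position
    0 and leading coefficient \<open>a 0\<close>.\<close>
  obtain n where n: "n \<noteq> 0"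
    and no_root: "\<And>y. (\<Sum>j\<le>d. (if j = 0 then of_int n else a (d - j)) * y ^ j) \<noteq> 0"
    using ex_int_coeff_without_root[of d 0 "\<lambda>j. a (d - j)"] assms True by auto
  have "(\<Sum>j\<le>d. (if j = i then of_int n else a j) * x ^ j) \<noteq> 0" for x
  proof (cases "x = 0")
    \<comment> \<open>Reversal says nothing about the root 0; there the value is \<open>a 0\<close>,
      nonzero since \<open>i = d > 0\<close>.\<close>
    case True
    then show ?thesis
      using assms \<open>i = d\<close> by (subst sum.remove[of _ 0]) (auto simp: sum.neutral)
  next
    case False
    have "(\<Sum>j\<le>d. (if j = i then of_int n else a j) * x ^ j) =
        (\<Sum>j\<le>d. (if d - j = i then of_int n else a (d - j)) * x ^ (d - j))"
      by (rule sum.reindex_bij_witness[of _ "\<lambda>j. d - j" "\<lambda>j. d - j"]) auto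
    \<comment> \<open>For nonzero \<open>x\<close> the value is \<open>x^d\<close> times the
      reversed polynomial at \<open>1/x\<close>.\<close>
    also have "\<dots> = (\<Sum>j\<le>d. x ^ d * ((if j = 0 then of_int n else a (d - j)) * inverse x ^ j))"
      using False \<open>i = d\<close> by (intro sum.cong) (auto simp: power_diff field_simps)
    also have "\<dots> = x ^ d * (\<Sum>j\<le>d. (if j = 0 then of_int n else a (d - j)) * inverse x ^ j)"
      by (simp add: sum_distrib_left)
    finally show ?thesis
      using False no_root by simp
  qed
  then show ?thesis
    using n by (auto simp: poly_sum poly_monom)
qed

end
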